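(* Suppose $\rho:\mathfrak b^n\to\mathfrak{gl}(2,\mathbb C)$ is a two dimensional indecomposable representation such that $\rho(h_i)$ is diagonalizable for all $i$. Then $\rho|_{\mathfrak b^1}$ is indecomposable, where $\mathfrak b^1=\mathfrak b\oplus\{0\}\oplus\cdots\oplus\{0\}$. Furthermore, $\rho(h_j)=\alpha_jI_2$ and $\rho(y_j)=0$ for all $j=2,\dots,n$, where $\alpha_j\in\mathbb C$.
   Context: $\mathfrak b\subset\mathfrak{sl}(2,\mathbb C)$ is the Lie algebra of lower triangular matrices, spanned by $h=\frac12\begin{pmatrix}1&0\\0&-1\end{pmatrix}$ and $y=\begin{pmatrix}0&0\\1&0\end{pmatrix}$, with $[h,y]=-y$. $\mathfrak b^n$ is the direct sum of $n$ copies of $\mathfrak b$; $h_i$ and $y_i$ are the elements with $h$, respectively $y$, in the $i$-th slot and $0$ elsewhere. $I_2$ is the $2\times2$ identity matrix. A representation is indecomposable if its space is not the direct sum of two nonzero invariant subspaces.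
   Formalization: The claim is proved after renumbering the n summands by some permutation: with the first summand fixed it is false, e.g. for n = 2 and ρ(x_1,x_2) = x_2, where ρ restricted to b^1 is zero and ρ(y_2) is nonzero. *)

theory Defs
  imports "HOL-Analysis.Analysis"
begin

text \<open>Complex scalar multiplication of matrices; \<open>scaleR\<close> only covers real scalars and
  \<open>*s\<close> only vectors.\<close>

definition cscale :: "complex \<Rightarrow> complex^'m^'k \<Rightarrow> complex^'m^'k"
  where "cscale c A = (\<chi> i j. c * A $ i $ j)"

definition commutator :: "complex^'d^'d \<Rightarrow> complex^'d^'d \<Rightarrow> complex^'d^'d"
  where "commutator A B = A ** B - B ** A"

definition diagonalizable :: "complex^'d^'d \<Rightarrow> bool"
  where "diagonalizable A \<longleftrightarrow>
    (\<exists>P D :: complex^'d^'d. invertible P \<and> (\<forall>i j. i \<noteq> j \<longrightarrow> D $ i $ j = 0) \<and> A = P ** D ** matrix_inv P)"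

definition h_mat :: "complex^2^2"
  where "h_mat = cscale (1/2) (vector [vector [1, 0], vector [0, -1]])"

definition y_mat :: "complex^2^2"
  where "y_mat = vector [vector [0, 0], vector [1, 0]]"

definition borel_alg :: "(complex^2^2) set"
  where "borel_alg = {X. trace X = 0 \<and> X $ 1 $ 2 = 0}"

lemma borel_alg_spanned:
  "borel_alg = {cscale a h_mat + cscale c y_mat |a c. True}"
proof -
  have "X = cscale (2 * X$1$1) h_mat + cscale (X$2$1) y_mat" if "X \<in> borel_alg" for X
    using that
    by (auto simp: borel_alg_def trace_def sum_2 vec_eq_iff forall_2 cscale_def h_mat_def y_mat_def
        vector_2 add_eq_0_iff)
  moreover have "cscale a h_mat + cscale c y_mat \<in> borel_alg" for a c
    by (simp add: borel_alg_def trace_def sum_2 cscale_def h_mat_def y_mat_def)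
  ultimately show ?thesis by blast
qed

lemma commutator_h_y: "commutator h_mat y_mat = - y_mat"
  by (simp add: commutator_def h_mat_def y_mat_def cscale_def matrix_matrix_mult_def vec_eq_iff
      forall_2 sum_2)

text \<open>An element of the direct sum of \<open>n\<close> copies is a family indexed by \<open>{1..n}\<close>. It is
  extended by \<open>0\<close> to all of \<open>nat\<close>, so that equal elements are equal functions.\<close>

definition borel_pow :: "nat \<Rightarrow> (nat \<Rightarrow> complex^2^2) set"
  where "borel_pow n = {x. (\<forall>i\<in>{1..n}. x i \<in> borel_alg) \<and> (\<forall>i. i \<notin> {1..n} \<longrightarrow> x i = 0)}"

definition slot :: "nat \<Rightarrow> complex^2^2 \<Rightarrow> nat \<Rightarrow> complex^2^2"
  where "slot i X = (\<lambda>k. if k = i then X else 0)"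

text \<open>Values of \<open>\<rho>\<close> outside \<open>borel_pow n\<close> are irrelevant.\<close>

definition lie_representation :: "nat \<Rightarrow> ((nat \<Rightarrow> complex^2^2) \<Rightarrow> complex^'d^'d) \<Rightarrow> bool"
  where "lie_representation n \<rho> \<longleftrightarrow>
    (\<forall>x\<in>borel_pow n. \<forall>z\<in>borel_pow n. \<rho> (\<lambda>i. x i + z i) = \<rho> x + \<rho> z) \<and>
    (\<forall>c. \<forall>x\<in>borel_pow n. \<rho> (\<lambda>i. cscale c (x i)) = cscale c (\<rho> x)) \<and>
    (\<forall>x\<in>borel_pow n. \<forall>z\<in>borel_pow n.
       \<rho> (\<lambda>i. commutator (x i) (z i)) = commutator (\<rho> x) (\<rho> z))"

definition invariant_subspace ::
    "'l set \<Rightarrow> ('l \<Rightarrow> complex^'d^'d) \<Rightarrow> (complex^'d) set \<Rightarrow> bool"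
  where "invariant_subspace L \<rho> W \<longleftrightarrow> vec.subspace W \<and> (\<forall>x\<in>L. \<forall>w\<in>W. \<rho> x *v w \<in> W)"

text \<open>Indecomposability of the restriction of \<open>\<rho>\<close> to \<open>L\<close>.\<close>

definition indecomposable :: "'l set \<Rightarrow> ('l \<Rightarrow> complex^'d^'d) \<Rightarrow> bool"
  where "indecomposable L \<rho> \<longleftrightarrow>
    \<not> (\<exists>U W. invariant_subspace L \<rho> U \<and> invariant_subspace L \<rho> W \<and>
           U \<noteq> {0} \<and> W \<noteq> {0} \<and> U \<inter> W = {0} \<and> {u + w |u w. u \<in> U \<and> w \<in> W} = UNIV)"

lemma diagonal_imp_diagonalizable:
  "(\<forall>i j. i \<noteq> j \<longrightarrow> D $ i $ j = 0) \<Longrightarrow> diagonalizable (D::complex^'d^'d)"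
proof -
  have "(mat 1::complex^'d^'d) ** matrix_inv (mat 1) = mat 1 \<and> matrix_inv (mat 1) ** (mat 1::complex^'d^'d) = mat 1"
    unfolding matrix_inv_def by (rule someI[of _ "mat 1"]) simp
  then have "matrix_inv (mat 1::complex^'d^'d) = mat 1" by (metis matrix_mul_lid)
  moreover have "invertible (mat 1::complex^'d^'d)" unfolding invertible_def by (metis matrix_mul_lid)
  moreover assume "\<forall>i j. i \<noteq> j \<longrightarrow> D $ i $ j = 0"
  ultimately show ?thesis unfolding diagonalizable_def
    by (intro exI[of _ "mat 1"] exI[of _ D]) simp
qed

text \<open>The hypotheses are symmetric in the slots, so they cannot single out the first one: the
  projection of the sum of two copies onto the second copy satisfies all of them, while its
  restriction to the first copy is zero. Hence the slot on which an indecomposable representation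
  stays indecomposable is the first one only after renumbering the slots.\<close>

lemma second_projection_counterexample:
  defines "\<rho> \<equiv> (\<lambda>x. x 2 :: complex^2^2)"
  shows "lie_representation 2 \<rho>" "indecomposable (borel_pow 2) \<rho>"
    "\<And>i. i \<in> {1..2} \<Longrightarrow> diagonalizable (\<rho> (slot i h_mat))"
    "\<not> indecomposable (slot 1 ` borel_alg) \<rho>"
proof -
  show "lie_representation 2 \<rho>" by (simp add: lie_representation_def \<rho>_def)
  show "diagonalizable (\<rho> (slot i h_mat))" if "i \<in> {1..2}" for i
    by (rule diagonal_imp_diagonalizable)
       (auto simp: \<rho>_def slot_def h_mat_def cscale_def forall_2)
  have yin: "slot 2 y_mat \<in> borel_pow 2"
    by (auto simp: borel_pow_def slot_def borel_alg_def y_mat_def trace_def sum_2)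
  have key: "axis 2 1 \<in> U" if "invariant_subspace (borel_pow 2) \<rho> U" "U \<noteq> {0}" for U
  proof -
    have sub: "vec.subspace U" and inv: "\<And>w. w \<in> U \<Longrightarrow> y_mat *v w \<in> U"
      using that yin by (force simp: invariant_subspace_def \<rho>_def slot_def)+
    obtain u where u: "u \<in> U" "u \<noteq> 0" using \<open>U \<noteq> {0}\<close> vec.subspace_0[OF sub] by blast
    show ?thesis
    proof (cases "u $ 1 = 0")
      case True
      then have "u $ 2 \<noteq> 0" using u(2) by (auto simp: vec_eq_iff forall_2)
      then have "axis 2 1 = inverse (u$2) *s u" using True by (simp add: vec_eq_iff forall_2 axis_def)
      then show ?thesis using vec.subspace_scale[OF sub u(1)] by metis
    next
      case False
      then have "axis 2 1 = inverse (u$1) *s (y_mat *v u)"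
        by (simp add: vec_eq_iff forall_2 axis_def y_mat_def matrix_vector_mult_def sum_2)
      then show ?thesis using vec.subspace_scale[OF sub inv[OF u(1)]] by metis
    qed
  qed
  have nz: "axis 2 1 \<noteq> (0::complex^2)" by (simp add: vec_eq_iff forall_2 axis_def)
  show "indecomposable (borel_pow 2) \<rho>"
    unfolding indecomposable_def using key nz by blast
  have "invariant_subspace (slot 1 ` borel_alg) \<rho> W" if "vec.subspace W" for W
    using that vec.subspace_0[OF that] by (auto simp: invariant_subspace_def \<rho>_def slot_def)
  moreover have "vec.subspace {w::complex^2. w $ k = 0}" for k
    by (simp add: vec.subspace_def)
  ultimately have i: "invariant_subspace (slot 1 ` borel_alg) \<rho> {w::complex^2. w $ k = 0}" for k by blast
  have n: "{w::complex^2. w $ 2 = 0} \<noteq> {0}" "{w::complex^2. w $ 1 = 0} \<noteq> {0}"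
  proof -
    have "axis 1 1 \<in> {w::complex^2. w $ 2 = 0}" "axis 1 1 \<noteq> (0::complex^2)" by (auto simp: vec_eq_iff forall_2 axis_def)
    then show "{w::complex^2. w $ 2 = 0} \<noteq> {0}" by blast
    have "axis 2 1 \<in> {w::complex^2. w $ 1 = 0}" by (auto simp: axis_def)
    then show "{w::complex^2. w $ 1 = 0} \<noteq> {0}" using nz by blast
  qed
  have s: "{u + w |u w. u \<in> {w::complex^2. w $ 2 = 0} \<and> w \<in> {w::complex^2. w $ 1 = 0}} = UNIV"
  proof -
    have "v \<in> {u + w |u w. u \<in> {w::complex^2. w $ 2 = 0} \<and> w \<in> {w::complex^2. w $ 1 = 0}}" for v
      by (rule CollectI, rule exI[of _ "axis 1 (v$1)"], rule exI[of _ "axis 2 (v$2)"])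
         (auto simp: vec_eq_iff forall_2 axis_def)
    then show ?thesis by blast
  qed
  have z: "{w::complex^2. w $ 2 = 0} \<inter> {w::complex^2. w $ 1 = 0} = {0}" by (auto simp: vec_eq_iff forall_2)
  show "\<not> indecomposable (slot 1 ` borel_alg) \<rho>"
    unfolding indecomposable_def not_not
    by (intro exI conjI) (rule i i[of 1] n s z)+
qed

end

theory Submission
  imports Defs
begin

text \<open>Write \<open>H\<^sub>i\<close> and \<open>Y\<^sub>i\<close> for the images of \<open>h\<^sub>i\<close> and \<open>y\<^sub>i\<close>. They satisfy
  \<open>[H\<^sub>i, Y\<^sub>i] = -Y\<^sub>i\<close>, and the operators of different slots commute. Everything rests on one
  property of \<open>2 \<times> 2\<close> matrices: whatever commutes with a non-scalar matrix \<open>A\<close> is a linear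
  combination of the identity and \<open>A\<close> (lemma \<open>commutes_nonscalar_imp_combination\<close>).

  Suppose first that some \<open>Y\<^sub>k\<close> is nonzero. Since \<open>[H\<^sub>k, Y\<^sub>k] = -Y\<^sub>k\<close>, it is not scalar. An
  operator from another slot commutes with \<open>Y\<^sub>k\<close>, so it is \<open>a + b Y\<^sub>k\<close>; it also commutes with
  \<open>H\<^sub>k\<close>, which gives \<open>b Y\<^sub>k = 0\<close>, so it is scalar. In particular
  \<open>Y\<^sub>j = -[H\<^sub>j, Y\<^sub>j] = 0\<close> for \<open>j \<noteq> k\<close>. The other slots preserve every subspace, so slot \<open>k\<close> has
  the same invariant subspaces as the whole algebra, and indecomposability carries over to it.
  The permutation exchanges \<open>1\<close> and \<open>k\<close>.

  If all \<open>Y\<^sub>i\<close> vanish, the image is spanned by the commuting diagonalizable matrices \<open>H\<^sub>i\<close>. A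
  non-scalar one among them, if there is any, generates all the others together with the
  identity. So the whole image lies in the span of the identity and a single diagonalizable
  matrix, and two independent eigenlines of the latter decompose the representation.\<close>

section \<open>Scalar multiples of matrices\<close>

lemma cscale_nth [simp]: "cscale c A $ i $ j = c * A $ i $ j"
  by (simp add: cscale_def)

lemma cscale_zero [simp]: "cscale 0 A = 0" "cscale c 0 = 0"
  by (simp_all add: vec_eq_iff)

lemma cscale_mult_vector: "cscale c A *v w = c *s (A *v w)"
  by (simp add: vec_eq_iff matrix_vector_mult_def sum_distrib_left mult.assoc)

lemma cscale_matrix_mult: "cscale c A ** B = cscale c (A ** B)"
  and matrix_mult_cscale: "A ** cscale c B = cscale c (A ** B)"
  by (simp_all add: vec_eq_iff matrix_matrix_mult_def sum_distrib_left mult.assoc mult.left_commute)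

lemma commutator_cscale_mat_1 [simp]: "commutator A (cscale c (mat 1)) = 0"
  "commutator (cscale c (mat 1)) A = 0"
  by (simp_all add: commutator_def cscale_matrix_mult matrix_mult_cscale)

lemma commutator_combination:
  fixes A B :: "complex^'d^'d"
  shows "commutator A (cscale a (mat 1) + cscale b B) = cscale b (commutator A B)"
proof -
  have "(B + C) ** A = B ** A + C ** A" for B C :: "complex^'d^'d"
    by (simp add: vec_eq_iff matrix_matrix_mult_def sum.distrib distrib_right)
  then show ?thesis
    by (simp add: commutator_def matrix_add_ldistrib cscale_matrix_mult matrix_mult_cscale)
      (simp add: vec_eq_iff right_diff_distrib)
qed

section \<open>The commutant of a non-scalar two by two matrix\<close>

text \<open>Subtracting the lower right entry times the identity identifies a matrix modulo scalars
  with the triple of its diagonal difference \<open>a\<^sub>1\<^sub>1 - a\<^sub>2\<^sub>2\<close> and its two off-diagonal entries. Two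
  matrices commute exactly when the cross product of their triples vanishes, that is, when the
  triples are linearly dependent. The triple of a non-scalar matrix is nonzero.\<close>

lemma commutes_nonscalar_imp_combination:
  fixes A B :: "complex^2^2"
  assumes nonscalar: "\<And>c. A \<noteq> cscale c (mat 1)" and comm: "commutator A B = 0"
  obtains a b where "B = cscale a (mat 1) + cscale b A"
proof -
  define p q r s where A: "p = A$1$1" "q = A$1$2" "r = A$2$1" "s = A$2$2"
  define t u v w where B: "t = B$1$1" "u = B$1$2" "v = B$2$1" "w = B$2$2"
  have "(A ** B) $ i $ j = (B ** A) $ i $ j" for i j
    using comm by (simp add: commutator_def)
  from this[of 1 1] this[of 1 2] this[of 2 1]
  have e: "q * v = u * r" "(p - s) * u = (t - w) * q" "(t - w) * r = (p - s) * v"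
    unfolding matrix_matrix_mult_def by (simp_all add: sum_2 flip: A B) algebra+
  have "q \<noteq> 0 \<or> r \<noteq> 0 \<or> p - s \<noteq> 0"
    using nonscalar[of p] by (auto simp: A vec_eq_iff forall_2 mat_def)
  then have "\<exists>b. t - w = b * (p - s) \<and> u = b * q \<and> v = b * r"
  proof (elim disjE)
    assume "q \<noteq> 0"
    then show ?thesis
      using e by (intro exI[of _ "u / q"]) (simp add: nonzero_eq_divide_eq eq_divide_eq mult.commute)
  next
    assume "r \<noteq> 0"
    then show ?thesis
      using e by (intro exI[of _ "v / r"]) (simp add: nonzero_eq_divide_eq eq_divide_eq mult.commute)
  next
    assume "p - s \<noteq> 0"
    then show ?thesis
      using e by (intro exI[of _ "(t - w) / (p - s)"]) (simp add: eq_divide_eq mult.commute)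
  qed
  then obtain b where b: "t - w = b * (p - s)" "u = b * q" "v = b * r" by blast
  then have "t = w - b * s + b * p" by algebra
  with b have "B = cscale (w - b * s) (mat 1) + cscale b A"
    by (simp add: A B vec_eq_iff forall_2 mat_def)
  then show thesis by (rule that)
qed

section \<open>Representations of the direct sum in terms of the generators\<close>

lemma h_mat_in_borel_alg: "h_mat \<in> borel_alg" and y_mat_in_borel_alg: "y_mat \<in> borel_alg"
  by (simp_all add: borel_alg_def trace_def sum_2 h_mat_def y_mat_def)

lemma zero_in_borel_alg: "0 \<in> borel_alg"
  by (simp add: borel_alg_def trace_def)

lemma cscale_in_borel_alg: "X \<in> borel_alg \<Longrightarrow> cscale c X \<in> borel_alg"
  by (simp add: borel_alg_def trace_def sum_2) (metis distrib_left mult_zero_right)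

lemma slot_in_borel_pow: "i \<in> {1..n} \<Longrightarrow> X \<in> borel_alg \<Longrightarrow> slot i X \<in> borel_pow n"
  by (auto simp: slot_def borel_pow_def zero_in_borel_alg)

lemma borel_alg_generators:
  assumes "X \<in> borel_alg"
  obtains a c where "X = cscale a h_mat + cscale c y_mat"
  using assms unfolding borel_alg_spanned by blast

context
  fixes n :: nat and \<rho> :: "(nat \<Rightarrow> complex^2^2) \<Rightarrow> complex^'d^'d"
  assumes rep: "lie_representation n \<rho>"
begin

lemma rep_add:
  "x \<in> borel_pow n \<Longrightarrow> z \<in> borel_pow n \<Longrightarrow> \<rho> (\<lambda>i. x i + z i) = \<rho> x + \<rho> z"
  using rep by (simp add: lie_representation_def)

lemma rep_zero: "\<rho> (\<lambda>i. 0) = 0"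
  using rep_add[of "\<lambda>i. 0" "\<lambda>i. 0"] by (simp add: borel_pow_def zero_in_borel_alg)

lemma rep_slot:
  assumes i: "i \<in> {1..n}"
  shows "\<rho> (slot i (cscale a h_mat + cscale c y_mat))
    = cscale a (\<rho> (slot i h_mat)) + cscale c (\<rho> (slot i y_mat))"
proof -
  have scale: "\<rho> (slot i (cscale b X)) = cscale b (\<rho> (slot i X))" if "X \<in> borel_alg" for b X
  proof -
    have "(\<lambda>k. cscale b (slot i X k)) = slot i (cscale b X)"
      by (auto simp: slot_def)
    moreover have "\<rho> (\<lambda>k. cscale b (slot i X k)) = cscale b (\<rho> (slot i X))"
      using rep slot_in_borel_pow[OF i that] unfolding lie_representation_def by blast
    ultimately show ?thesis by simp
  qed
  have "(\<lambda>k. slot i (cscale a h_mat) k + slot i (cscale c y_mat) k)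
      = slot i (cscale a h_mat + cscale c y_mat)"
    by (auto simp: slot_def)
  then show ?thesis
    using rep_add[of "slot i (cscale a h_mat)" "slot i (cscale c y_mat)"]
    by (simp add: slot_in_borel_pow[OF i] cscale_in_borel_alg h_mat_in_borel_alg
        y_mat_in_borel_alg scale)
qed

lemma rep_eq_sum_slots:
  assumes x: "x \<in> borel_pow n"
  shows "\<rho> x = (\<Sum>i = 1..n. \<rho> (slot i (x i)))"
proof -
  have "\<rho> (\<lambda>i. if i \<le> m then x i else 0) = (\<Sum>i = 1..m. \<rho> (slot i (x i)))" if "m \<le> n" for m
    using that
  proof (induction m)
    case 0
    \<comment> \<open>The family vanishes at index \<open>0\<close>, which is not a slot.\<close>
    have "(\<lambda>i. if i \<le> 0 then x i else 0) = (\<lambda>i. 0)"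
      using x by (auto simp: borel_pow_def)
    then show ?case by (simp add: rep_zero)
  next
    case (Suc m)
    let ?y = "\<lambda>i. if i \<le> m then x i else 0" and ?z = "slot (Suc m) (x (Suc m))"
    have y: "?y \<in> borel_pow n"
      using x by (auto simp: borel_pow_def zero_in_borel_alg)
    have z: "?z \<in> borel_pow n"
      using x Suc.prems by (intro slot_in_borel_pow) (auto simp: borel_pow_def)
    have "(\<lambda>i. if i \<le> Suc m then x i else 0) = (\<lambda>i. ?y i + ?z i)"
      by (auto simp: slot_def le_Suc_eq)
    then have "\<rho> (\<lambda>i. if i \<le> Suc m then x i else 0) = \<rho> ?y + \<rho> ?z"
      by (simp only: rep_add[OF y z])
    also have "\<rho> ?y = (\<Sum>i = 1..m. \<rho> (slot i (x i)))"
      using Suc.prems by (intro Suc.IH) simp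
    finally show ?case by simp
  qed
  from this[of n] have "\<rho> (\<lambda>i. if i \<le> n then x i else 0) = (\<Sum>i = 1..n. \<rho> (slot i (x i)))"
    by blast
  moreover have "(\<lambda>i. if i \<le> n then x i else 0) = x"
    using x by (intro ext) (simp add: borel_pow_def)
  ultimately show ?thesis by simp
qed

lemma invariant_subspace_generatorsI:
  assumes W: "vec.subspace W"
    and h: "\<And>i w. i \<in> {1..n} \<Longrightarrow> w \<in> W \<Longrightarrow> \<rho> (slot i h_mat) *v w \<in> W"
    and y: "\<And>i w. i \<in> {1..n} \<Longrightarrow> w \<in> W \<Longrightarrow> \<rho> (slot i y_mat) *v w \<in> W"
  shows "invariant_subspace (borel_pow n) \<rho> W"
  unfolding invariant_subspace_def
proof (intro conjI ballI W)
  fix x w assume x: "x \<in> borel_pow n" and w: "w \<in> W"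
  have "\<rho> (slot i (x i)) *v w \<in> W" if i: "i \<in> {1..n}" for i
  proof -
    have "x i \<in> borel_alg" using x i by (simp add: borel_pow_def)
    then obtain a c where "x i = cscale a h_mat + cscale c y_mat" by (rule borel_alg_generators)
    then show ?thesis
      using i w by (simp add: rep_slot matrix_vector_mult_add_rdistrib cscale_mult_vector
          vec.subspace_add[OF W] vec.subspace_scale[OF W] h y)
  qed
  moreover have "(\<Sum>i\<in>I. M i) *v w = (\<Sum>i\<in>I. M i *v w)"
    for I :: "nat set" and M :: "nat \<Rightarrow> complex^'d^'d"
    by (induction I rule: infinite_finite_induct) (simp_all add: matrix_vector_mult_add_rdistrib)
  ultimately show "\<rho> x *v w \<in> W"
    by (auto simp: rep_eq_sum_slots[OF x] intro: vec.subspace_sum[OF W])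
qed

lemma rep_commutator:
  assumes "i \<in> {1..n}" "X \<in> borel_alg" "j \<in> {1..n}" "Z \<in> borel_alg"
  shows "commutator (\<rho> (slot i X)) (\<rho> (slot j Z))
    = \<rho> (\<lambda>k. commutator (slot i X k) (slot j Z k))"
  using rep slot_in_borel_pow[OF assms(1,2)] slot_in_borel_pow[OF assms(3,4)]
  unfolding lie_representation_def by simp

lemma rep_commutator_distinct_slots:
  assumes "i \<in> {1..n}" "X \<in> borel_alg" "j \<in> {1..n}" "Z \<in> borel_alg" "i \<noteq> j"
  shows "commutator (\<rho> (slot i X)) (\<rho> (slot j Z)) = 0"
proof -
  have "(\<lambda>k. commutator (slot i X k) (slot j Z k)) = (\<lambda>k. 0)"
    using \<open>i \<noteq> j\<close> by (auto simp: slot_def commutator_def)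
  then show ?thesis using assms by (simp add: rep_commutator rep_zero)
qed

lemma rep_commutator_h_h:
  assumes "i \<in> {1..n}" "j \<in> {1..n}"
  shows "commutator (\<rho> (slot i h_mat)) (\<rho> (slot j h_mat)) = 0"
proof (cases "i = j")
  case True
  then show ?thesis by (simp add: commutator_def)
next
  case False
  then show ?thesis using assms by (simp add: rep_commutator_distinct_slots h_mat_in_borel_alg)
qed

lemma rep_commutator_h_y:
  assumes i: "i \<in> {1..n}"
  shows "commutator (\<rho> (slot i h_mat)) (\<rho> (slot i y_mat)) = - \<rho> (slot i y_mat)"
proof -
  have "(\<lambda>k. commutator (slot i h_mat k) (slot i y_mat k))
      = slot i (cscale 0 h_mat + cscale (-1) y_mat)"
  proof
    fix k
    have "commutator 0 0 = (0 :: complex^2^2)" and "cscale (-1) y_mat = - y_mat"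
      by (simp_all add: commutator_def vec_eq_iff)
    then show "commutator (slot i h_mat k) (slot i y_mat k)
        = slot i (cscale 0 h_mat + cscale (-1) y_mat) k"
      by (simp add: slot_def commutator_h_y)
  qed
  then have "commutator (\<rho> (slot i h_mat)) (\<rho> (slot i y_mat)) = cscale (-1) (\<rho> (slot i y_mat))"
    using i by (simp only: rep_commutator h_mat_in_borel_alg y_mat_in_borel_alg rep_slot) simp
  then show ?thesis by (simp add: vec_eq_iff)
qed

lemma rep_h_scalar_imp_y_zero:
  assumes "i \<in> {1..n}" "\<rho> (slot i h_mat) = cscale c (mat 1)"
  shows "\<rho> (slot i y_mat) = 0"
  using rep_commutator_h_y[OF assms(1)] by (simp add: assms(2))

end

section \<open>Decomposable and indecomposable representations\<close>

lemma indecomposable_if_fewer_invariant_subspaces: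
  assumes "indecomposable L \<rho>"
    and "\<And>W. invariant_subspace K \<rho> W \<Longrightarrow> invariant_subspace L \<rho> W"
  shows "indecomposable K \<rho>"
  using assms unfolding indecomposable_def by blast

text \<open>If \<open>A = P D P\<inverse>\<close> with \<open>D\<close> diagonal, each line on which one coordinate of \<open>P\<inverse> v\<close>
  vanishes lies in an eigenspace of \<open>A\<close>.\<close>

lemma diagonalizable_invariant_complements:
  fixes A :: "complex^2^2"
  assumes "diagonalizable A"
  obtains U W :: "(complex^2) set" where "vec.subspace U" "vec.subspace W"
    "\<forall>v\<in>U. A *v v \<in> U" "\<forall>v\<in>W. A *v v \<in> W"
    "U \<noteq> {0}" "W \<noteq> {0}" "U \<inter> W = {0}" "{u + w |u w. u \<in> U \<and> w \<in> W} = UNIV"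
proof -
  obtain P D :: "complex^2^2" where P: "invertible P"
    and D: "\<And>i j. i \<noteq> j \<Longrightarrow> D $ i $ j = 0" and A: "A = P ** D ** matrix_inv P"
    using assms unfolding diagonalizable_def by blast
  define Q where "Q = matrix_inv P"
  have PQ: "P ** Q = mat 1" and QP: "Q ** P = mat 1"
    using someI_ex[OF P[unfolded invertible_def]] by (simp_all add: Q_def matrix_inv_def)
  have PQv: "P *v (Q *v v) = v" and QPv: "Q *v (P *v v) = v" for v
    by (simp_all add: matrix_vector_mul_assoc PQ QP)
  define E where "E k = {v. (Q *v v) $ k = 0}" for k
  have sub: "vec.subspace (E k)" for k
    by (simp add: E_def vec.subspace_def matrix_vector_right_distrib vector_scalar_commute)
  have "Q *v (A *v v) = D *v (Q *v v)" for v
    by (simp add: A QPv flip: Q_def matrix_vector_mul_assoc)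
  moreover have "(D *v v) $ k = D $ k $ k * v $ k" for v k
    using exhaust_2[of k] by (auto simp: matrix_vector_mult_def sum_2 D)
  ultimately have inv: "A *v v \<in> E k" if "v \<in> E k" for v k
    using that by (simp add: E_def)
  have mem: "P *v axis l c \<in> E k" if "l \<noteq> k" for l k c
    using that by (simp add: E_def QPv axis_def)
  have "P *v axis l 1 \<noteq> 0" for l
    using QPv[of "axis l 1"] by (auto simp: axis_eq_0_iff)
  with mem[of 1 2] mem[of 2 1] have nz: "E 2 \<noteq> {0}" "E 1 \<noteq> {0}"
    by force+
  have "v = 0" if "Q *v v = 0" for v
    using PQv[of v] that by simp
  then have "E 2 \<inter> E 1 = {0}"
    by (auto simp: E_def vec_eq_iff[of "Q *v _"] forall_2)
  moreover have "{u + w |u w. u \<in> E 2 \<and> w \<in> E 1} = UNIV"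
  proof -
    have "v = P *v axis 1 ((Q *v v) $ 1) + P *v axis 2 ((Q *v v) $ 2)" for v
    proof -
      have "axis 1 ((Q *v v) $ 1) + axis 2 ((Q *v v) $ 2) = Q *v v"
        by (simp add: vec_eq_iff forall_2 axis_def)
      then show ?thesis by (simp add: PQv flip: matrix_vector_right_distrib)
    qed
    with mem[of 1 2] mem[of 2 1] show ?thesis by fastforce
  qed
  ultimately show thesis using that[of "E 2" "E 1"] sub inv nz by blast
qed

text \<open>Every \<open>H\<^sub>i\<close> is a combination of the identity and one fixed \<open>H\<^sub>k\<close>: a non-scalar one if it
  exists, and otherwise \<open>H\<^sub>1\<close>. As the \<open>Y\<^sub>i\<close> vanish, the eigenlines of \<open>H\<^sub>k\<close> are invariant.\<close>

lemma not_indecomposable_if_y_zero: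
  fixes \<rho> :: "(nat \<Rightarrow> complex^2^2) \<Rightarrow> complex^2^2"
  assumes "n \<ge> 1" and rep: "lie_representation n \<rho>"
    and diag: "\<And>i. i \<in> {1..n} \<Longrightarrow> diagonalizable (\<rho> (slot i h_mat))"
    and y: "\<And>i. i \<in> {1..n} \<Longrightarrow> \<rho> (slot i y_mat) = 0"
  shows "\<not> indecomposable (borel_pow n) \<rho>"
proof -
  have "\<exists>k\<in>{1..n}. \<forall>i\<in>{1..n}. \<exists>a b.
      \<rho> (slot i h_mat) = cscale a (mat 1) + cscale b (\<rho> (slot k h_mat))"
  proof (cases "\<exists>k\<in>{1..n}. \<forall>c. \<rho> (slot k h_mat) \<noteq> cscale c (mat 1)")
    case True
    then obtain k where k: "k \<in> {1..n}"
      and nonscalar: "\<And>c. \<rho> (slot k h_mat) \<noteq> cscale c (mat 1)"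
      by blast
    show ?thesis
    proof (rule bexI[OF ballI k])
      fix i assume i: "i \<in> {1..n}"
      obtain a b where "\<rho> (slot i h_mat) = cscale a (mat 1) + cscale b (\<rho> (slot k h_mat))"
        by (rule commutes_nonscalar_imp_combination[OF nonscalar rep_commutator_h_h[OF rep k i]])
      then show "\<exists>a b. \<rho> (slot i h_mat) = cscale a (mat 1) + cscale b (\<rho> (slot k h_mat))"
        by (intro exI)
    qed
  next
    case False
    have one: "1 \<in> {1..n}" using \<open>n \<ge> 1\<close> by simp
    show ?thesis
    proof (rule bexI[OF ballI one])
      fix i assume "i \<in> {1..n}"
      moreover have "\<forall>k\<in>{1..n}. \<exists>c. \<rho> (slot k h_mat) = cscale c (mat 1)"
        using False by simp
      ultimately obtain c where "\<rho> (slot i h_mat) = cscale c (mat 1)"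
        by (blast dest: bspec)
      then have "\<rho> (slot i h_mat) = cscale c (mat 1) + cscale 0 (\<rho> (slot 1 h_mat))"
        by (simp only: cscale_zero add_0_right)
      then show "\<exists>a b. \<rho> (slot i h_mat) = cscale a (mat 1) + cscale b (\<rho> (slot 1 h_mat))"
        by (intro exI)
    qed
  qed
  then obtain k where k: "k \<in> {1..n}" and comb: "\<forall>i\<in>{1..n}. \<exists>a b.
      \<rho> (slot i h_mat) = cscale a (mat 1) + cscale b (\<rho> (slot k h_mat))"
    by (rule bexE)
  have inv: "invariant_subspace (borel_pow n) \<rho> W"
    if W: "vec.subspace W" and A: "\<And>v. v \<in> W \<Longrightarrow> \<rho> (slot k h_mat) *v v \<in> W" for W
  proof (rule invariant_subspace_generatorsI[OF rep W])
    fix i w assume i: "i \<in> {1..n}" and w: "w \<in> W"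
    obtain a b where "\<rho> (slot i h_mat) = cscale a (mat 1) + cscale b (\<rho> (slot k h_mat))"
      using bspec[OF comb i] by blast
    then show "\<rho> (slot i h_mat) *v w \<in> W"
      using w by (simp add: matrix_vector_mult_add_rdistrib cscale_mult_vector
          vec.subspace_add[OF W] vec.subspace_scale[OF W] A)
    show "\<rho> (slot i y_mat) *v w \<in> W"
      by (simp add: y[OF i] vec.subspace_0[OF W])
  qed
  obtain U W where "vec.subspace U" "vec.subspace W"
    "\<forall>v\<in>U. \<rho> (slot k h_mat) *v v \<in> U" "\<forall>v\<in>W. \<rho> (slot k h_mat) *v v \<in> W"
    "U \<noteq> {0}" "W \<noteq> {0}" "U \<inter> W = {0}" "{u + w |u w. u \<in> U \<and> w \<in> W} = UNIV"
    by (rule diagonalizable_invariant_complements[OF diag[OF k]])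
  moreover from this have "invariant_subspace (borel_pow n) \<rho> U"
      "invariant_subspace (borel_pow n) \<rho> W"
    by (simp_all add: inv)
  ultimately show ?thesis
    unfolding indecomposable_def not_not by (intro exI[of _ U] exI[of _ W] conjI)
qed

text \<open>Commuting with \<open>Y\<^sub>k\<close> confines \<open>H\<^sub>j\<close> to the combinations \<open>a + b Y\<^sub>k\<close>, and commuting with
  \<open>H\<^sub>k\<close> excludes \<open>b \<noteq> 0\<close>, because \<open>[H\<^sub>k, a + b Y\<^sub>k] = -b Y\<^sub>k\<close>.\<close>

lemma other_slots_scalar_if_y_nonzero:
  fixes \<rho> :: "(nat \<Rightarrow> complex^2^2) \<Rightarrow> complex^2^2"
  assumes rep: "lie_representation n \<rho>" and k: "k \<in> {1..n}" and nz: "\<rho> (slot k y_mat) \<noteq> 0"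
    and j: "j \<in> {1..n}" "j \<noteq> k"
  obtains a where "\<rho> (slot j h_mat) = cscale a (mat 1)" "\<rho> (slot j y_mat) = 0"
proof -
  let ?H = "\<rho> (slot k h_mat)" and ?Y = "\<rho> (slot k y_mat)" and ?B = "\<rho> (slot j h_mat)"
  have HY: "commutator ?H ?Y = - ?Y" by (rule rep_commutator_h_y[OF rep k])
  then have nonscalar: "?Y \<noteq> cscale c (mat 1)" for c
    using nz by (metis commutator_cscale_mat_1(1) neg_equal_0_iff_equal)
  have YB: "commutator ?Y ?B = 0" and HB: "commutator ?H ?B = 0"
    using k j by (simp_all add: rep_commutator_distinct_slots[OF rep] h_mat_in_borel_alg
        y_mat_in_borel_alg)
  obtain a b where B: "?B = cscale a (mat 1) + cscale b ?Y"
    by (rule commutes_nonscalar_imp_combination[OF nonscalar YB])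
  then have "cscale b (- ?Y) = 0" using HB HY by (metis commutator_combination)
  then have "cscale b ?Y = 0" by (simp add: vec_eq_iff)
  then have "?B = cscale a (mat 1)" using B by simp
  with rep_h_scalar_imp_y_zero[OF rep j(1)] that show thesis by blast
qed

theorem lemma6p5:
  fixes n :: nat
    and \<rho> :: "(nat \<Rightarrow> complex^2^2) \<Rightarrow> complex^2^2"
  assumes "n \<ge> 1"
    and "lie_representation n \<rho>"
    and "indecomposable (borel_pow n) \<rho>"
    and "\<And>i. i \<in> {1..n} \<Longrightarrow> diagonalizable (\<rho> (slot i h_mat))"
  shows "\<exists>\<sigma>. \<sigma> permutes {1..n} \<and>
    indecomposable (slot (\<sigma> 1) ` borel_alg) \<rho> \<and>
    (\<forall>j\<in>{2..n}. \<exists>\<alpha>. \<rho> (slot (\<sigma> j) h_mat) = cscale \<alpha> (mat 1) \<and> \<rho> (slot (\<sigma> j) y_mat) = 0)"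
proof -
  note rep = assms(2)
  obtain k where k: "k \<in> {1..n}" and nz: "\<rho> (slot k y_mat) \<noteq> 0"
    using not_indecomposable_if_y_zero[OF assms(1,2,4)] assms(3) by blast
  note others = other_slots_scalar_if_y_nonzero[OF rep k nz]
  have indec: "indecomposable (slot k ` borel_alg) \<rho>"
  proof (rule indecomposable_if_fewer_invariant_subspaces[OF assms(3)])
    fix W assume "invariant_subspace (slot k ` borel_alg) \<rho> W"
    then have W: "vec.subspace W"
      and slot_k: "\<And>X w. X \<in> borel_alg \<Longrightarrow> w \<in> W \<Longrightarrow> \<rho> (slot k X) *v w \<in> W"
      by (auto simp: invariant_subspace_def)
    have "\<rho> (slot i h_mat) *v w \<in> W \<and> \<rho> (slot i y_mat) *v w \<in> W"
      if i: "i \<in> {1..n}" and w: "w \<in> W" for i w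
    proof (cases "i = k")
      case True
      then show ?thesis using w by (simp add: slot_k h_mat_in_borel_alg y_mat_in_borel_alg)
    next
      case False
      obtain a where "\<rho> (slot i h_mat) = cscale a (mat 1)" "\<rho> (slot i y_mat) = 0"
        by (rule others[OF i False])
      then show ?thesis
        using w by (simp add: cscale_mult_vector vec.subspace_scale[OF W] vec.subspace_0[OF W])
    qed
    then show "invariant_subspace (borel_pow n) \<rho> W"
      using invariant_subspace_generatorsI[OF rep W] by blast
  qed
  define \<sigma> where "\<sigma> = Transposition.transpose 1 k"
  have \<sigma>: "\<sigma> permutes {1..n}"
    unfolding \<sigma>_def using k assms(1) by (intro permutes_swap_id) auto
  have \<sigma>1: "\<sigma> 1 = k" by (simp add: \<sigma>_def)
  have "\<exists>\<alpha>. \<rho> (slot (\<sigma> j) h_mat) = cscale \<alpha> (mat 1) \<and> \<rho> (slot (\<sigma> j) y_mat) = 0"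
    if j: "j \<in> {2..n}" for j
  proof -
    have "\<sigma> j \<in> {1..n}" using j by (simp only: permutes_in_image[OF \<sigma>]) simp
    moreover have "\<sigma> j \<noteq> k"
      using j inj_eq[OF permutes_inj[OF \<sigma>], of j 1] unfolding \<sigma>1 by simp
    ultimately obtain a where "\<rho> (slot (\<sigma> j) h_mat) = cscale a (mat 1)" "\<rho> (slot (\<sigma> j) y_mat) = 0"
      by (rule others)
    then show ?thesis by (intro exI conjI)
  qed
  then show ?thesis
    using \<sigma> indec by (intro exI[of _ \<sigma>] conjI ballI) (simp_all only: \<sigma>1)
qed

end
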